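(* For every $d\in\mathbb{N}$, there is a level-aware isolation scheme for maximum-size independent sets in graphs of treedepth at most $d$ that uses $\mathcal{O}(d)$ random bits and assigns weights bounded by $\mathcal{O}(n^6)$, where $n$ is the number of vertices.
   Context: A rooted forest $F$: each node has at most one parent; $y$ is an ancestor of $x$ if $y$ is reachable from $x$ by following parents (every node is its own ancestor). The level $\mathrm{lvl}_F(x)$ is the number of strict ancestors of $x$ (roots have level $0$); the height of $F$ is the maximum level plus one. An elimination forest of a graph $G$ is a rooted forest with $V(F)=V(G)$ such that for every edge $uv$, $u$ is an ancestor of $v$ or vice versa; the treedepth of $G$ is the minimum height of an elimination forest. For $\omega\colon U\to\mathbb{N}$, $\omega(X)=\sum_{e\in X}\omega(e)$, and $\omega$ isolates $\mathcal{F}\subseteq 2^U$ if exactly one member of $\mathcal{F}$ attains the minimum weight. $\mathsf{MIS}(G)$ is the family of maximum-size independent sets of $G$. A vertex selection problem $\mathcal{P}$ admits a level-aware isolation scheme if for all $n,d$ there exist functions $\omega_1,\ldots,\omega_\ell\colon[n]\times\{0,\ldots,d-1\}\to\mathbb{N}$ such that for every graph $G$ on vertex set $[n]$ and every elimination forest $F$ of $G$ of height at most $d$, at least half of the functions isolate $\mathcal{P}(G)$, where $\omega_i$ is evaluated on vertex $u$ as $\omega_i(u,\mathrm{lvl}_F(u))$. It uses $\log\ell$ random bits and its maximum weight is the largest value of the $\omega_i$. *)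

theory Defs
  imports Complex_Main
begin

text \<open>A simple undirected graph is a finite vertex set together with a symmetric irreflexive
  adjacency relation on it.\<close>

type_synonym 'a graph = "'a set \<times> 'a rel"

definition verts :: "'a graph \<Rightarrow> 'a set" where
  "verts G = fst G"

definition adj :: "'a graph \<Rightarrow> 'a rel" where
  "adj G = snd G"

definition simple_graph :: "'a graph \<Rightarrow> bool" where
  "simple_graph G \<longleftrightarrow>
     finite (verts G) \<and> adj G \<subseteq> verts G \<times> verts G \<and> sym (adj G) \<and> irrefl (adj G)"

text \<open>A rooted forest on \<open>V\<close> is given by its parent relation: \<open>(x, y) \<in> F\<close> means that \<open>y\<close> is the
  parent of \<open>x\<close>.\<close>

definition rooted_forest :: "'a set \<Rightarrow> 'a rel \<Rightarrow> bool" where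
  "rooted_forest V F \<longleftrightarrow> finite V \<and> F \<subseteq> V \<times> V \<and> single_valued F \<and> acyclic F"

definition ancestor :: "'a rel \<Rightarrow> 'a \<Rightarrow> 'a \<Rightarrow> bool" where
  "ancestor F y x \<longleftrightarrow> (x, y) \<in> F\<^sup>*"

definition lvl :: "'a rel \<Rightarrow> 'a \<Rightarrow> nat" where
  "lvl F x = card {y. ancestor F y x \<and> y \<noteq> x}"

text \<open>The empty forest has height 0.\<close>

definition height :: "'a set \<Rightarrow> 'a rel \<Rightarrow> nat" where
  "height V F = (if V = {} then 0 else Max (lvl F ` V) + 1)"

definition elimination_forest :: "'a graph \<Rightarrow> 'a rel \<Rightarrow> bool" where
  "elimination_forest G F \<longleftrightarrow>
     rooted_forest (verts G) F \<and> (\<forall>(u, v) \<in> adj G. ancestor F u v \<or> ancestor F v u)"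

definition treedepth :: "'a graph \<Rightarrow> nat" where
  "treedepth G = (LEAST h. \<exists>F. elimination_forest G F \<and> height (verts G) F = h)"

definition isolates :: "('a \<Rightarrow> nat) \<Rightarrow> 'a set set \<Rightarrow> bool" where
  "isolates \<omega> \<F> \<longleftrightarrow> (\<exists>!X. is_arg_min (\<lambda>X. \<Sum>e\<in>X. \<omega> e) (\<lambda>X. X \<in> \<F>) X)"

definition independent :: "'a graph \<Rightarrow> 'a set \<Rightarrow> bool" where
  "independent G I \<longleftrightarrow> I \<subseteq> verts G \<and> (\<forall>u\<in>I. \<forall>v\<in>I. (u, v) \<notin> adj G)"

definition MIS :: "'a graph \<Rightarrow> 'a set set" where
  "MIS G = {I. is_arg_max card (independent G) I}"

text \<open>The list \<open>ws\<close> enumerates the weight functions \<open>\<omega>\<^sub>1, \<dots>, \<omega>\<^sub>\<ell>\<close> (repetitions allowed) for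
  parameters \<open>n\<close> and \<open>d\<close>, the vertex set \<open>[n]\<close> being \<open>{1..n}\<close>. Only the values on
  \<open>{1..n} \<times> {..<d}\<close> matter: vertices of a forest of height at most \<open>d\<close> have level less than \<open>d\<close>.
  The list has to be nonempty, as otherwise the requirement that half of its members isolate would
  be void. That the graph has treedepth at most \<open>d\<close> is implicit in the existence of \<open>F\<close>; see
  \<open>treedepth_le_iff\<close> below.\<close>

definition level_aware_isolation_scheme ::
    "(nat graph \<Rightarrow> nat set set) \<Rightarrow> nat \<Rightarrow> nat \<Rightarrow> (nat \<Rightarrow> nat \<Rightarrow> nat) list \<Rightarrow> bool" where
  "level_aware_isolation_scheme \<P> n d ws \<longleftrightarrow>
     ws \<noteq> [] \<and>
     (\<forall>G F. simple_graph G \<and> verts G = {1..n} \<and>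
            elimination_forest G F \<and> height (verts G) F \<le> d \<longrightarrow>
            real (length (filter (\<lambda>\<omega>. isolates (\<lambda>u. \<omega> u (lvl F u)) (\<P> G)) ws))
              \<ge> real (length ws) / 2)"

definition random_bits :: "(nat \<Rightarrow> nat \<Rightarrow> nat) list \<Rightarrow> real" where
  "random_bits ws = log 2 (real (length ws))"

text \<open>The \<open>insert 0\<close> covers the case where \<open>{1..n} \<times> {..<d}\<close> is empty.\<close>

definition max_weight :: "nat \<Rightarrow> nat \<Rightarrow> (nat \<Rightarrow> nat \<Rightarrow> nat) list \<Rightarrow> nat" where
  "max_weight n d ws =
     Max (insert 0 {\<omega> u i | \<omega> u i. \<omega> \<in> set ws \<and> u \<in> {1..n} \<and> i < d})"

lemma elimination_forest_exists:
  fixes G :: "nat graph"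
  assumes "simple_graph G"
  shows "\<exists>F. elimination_forest G F"
proof -
  let ?V = "verts G"
  have fin: "finite ?V" and sub: "adj G \<subseteq> ?V \<times> ?V"
    using assms by (auto simp: simple_graph_def)
  define F where "F = {(x, y). x \<in> ?V \<and> y \<in> ?V \<and> y < x \<and> (\<forall>z\<in>?V. z < x \<longrightarrow> z \<le> y)}"
  have "acyclic F"
  proof (rule acyclic_subset)
    show "F \<subseteq> less_than\<inverse>" by (auto simp: F_def)
    show "acyclic (less_than\<inverse>)" by (simp add: wf_acyclic)
  qed
  moreover have "single_valued F"
    by (auto simp: single_valued_def F_def intro!: antisym)
  ultimately have forest: "rooted_forest ?V F"
    using fin by (auto simp: rooted_forest_def F_def)
  have anc: "y \<in> ?V \<Longrightarrow> y \<le> x \<Longrightarrow> (x, y) \<in> F\<^sup>*" if "x \<in> ?V" for x y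
    using that
  proof (induction x rule: less_induct)
    case (less x)
    show ?case
    proof (cases "x = y")
      case False
      let ?S = "{z \<in> ?V. z < x}"
      have S: "finite ?S" "y \<in> ?S" using fin less.prems False by auto
      define p where "p = Max ?S"
      have p: "p \<in> ?S" "y \<le> p"
        unfolding p_def using Max_in[OF S(1)] Max_ge[OF S] S(2) by blast+
      have "(x, p) \<in> F"
        using p less.prems S by (auto simp: F_def p_def)
      moreover have "(p, y) \<in> F\<^sup>*" using less.IH[of p] p less.prems by auto
      ultimately show ?thesis by (rule converse_rtrancl_into_rtrancl)
    qed auto
  qed
  have "ancestor F u v \<or> ancestor F v u" if "(u, v) \<in> adj G" for u v
    using that sub anc[of u v] anc[of v u] linear[of u v] by (auto simp: ancestor_def)
  with forest show ?thesis by (auto simp: elimination_forest_def)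
qed

lemma treedepth_le_iff:
  fixes G :: "nat graph"
  assumes "simple_graph G"
  shows "treedepth G \<le> d \<longleftrightarrow> (\<exists>F. elimination_forest G F \<and> height (verts G) F \<le> d)"
proof
  assume "treedepth G \<le> d"
  moreover have "\<exists>F. elimination_forest G F \<and> height (verts G) F = treedepth G"
    unfolding treedepth_def
    by (rule LeastI_ex) (use elimination_forest_exists[OF assms] in blast)
  ultimately show "\<exists>F. elimination_forest G F \<and> height (verts G) F \<le> d"
    by metis
next
  assume "\<exists>F. elimination_forest G F \<and> height (verts G) F \<le> d"
  then obtain F where "elimination_forest G F" "height (verts G) F \<le> d" by blast
  then show "treedepth G \<le> d"
    unfolding treedepth_def by (metis (mono_tags, lifting) Least_le order_trans)
qed

end

theory Submission
  imports Defs "HOL-Library.FuncSet"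
begin

text \<open>If \<open>2 ^ d \<le> n\<close>, the single function giving weight \<open>2 ^ j\<close> to level \<open>j\<close> isolates. Given two
  distinct optimal sets, take a vertex \<open>u\<close> of minimum level \<open>l\<close> on which they disagree. They agree on
  the strict ancestors of \<open>u\<close>, so exchanging their parts below \<open>u\<close> produces two independent sets,
  again optimal; hence the two parts below \<open>u\<close> have the same weight. But only one of them
  contains \<open>u\<close>, and all other vertices there have weight divisible by \<open>2 ^ (l + 1)\<close>.

  If \<open>n < 2 ^ d\<close>, then \<open>n\<^sup>2\<close> functions are affordable and the levels can be ignored: by the
  isolation lemma all but \<open>1/16\<close> of the functions into \<open>{..<16 * n}\<close> isolate \<open>MIS G\<close> for a fixed \<open>G\<close>,
  and since there are at most \<open>2 ^ n\<^sup>2\<close> graphs, some choice of \<open>n\<^sup>2\<close> functions serves all of them.\<close>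

text \<open>Natural weights attain a minimum on every nonempty family, even an infinite one, so
  isolation can fail only through a tie.\<close>

lemma not_isolates_obtain:
  fixes \<omega> :: "'a \<Rightarrow> nat"
  assumes "\<not> isolates \<omega> \<F>" "\<F> \<noteq> {}"
  obtains X Y where "X \<noteq> Y"
    "is_arg_min (sum \<omega>) (\<lambda>X. X \<in> \<F>) X" "is_arg_min (sum \<omega>) (\<lambda>X. X \<in> \<F>) Y"
proof -
  obtain Z where "Z \<in> \<F>" using assms(2) by blast
  then have "is_arg_min (sum \<omega>) (\<lambda>X. X \<in> \<F>) (arg_min (sum \<omega>) (\<lambda>X. X \<in> \<F>))"
    unfolding is_arg_min_linorder
    using arg_min_natI[of "\<lambda>X. X \<in> \<F>" Z] arg_min_nat_le[of "\<lambda>X. X \<in> \<F>" _ "sum \<omega>"] by simp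
  then show ?thesis
    using assms(1) that unfolding isolates_def by blast
qed

lemma MIS_nonempty:
  assumes "finite (verts G)"
  shows "MIS G \<noteq> {}"
proof -
  have fin: "finite {I. independent G I}"
    using assms by (rule_tac finite_subset[of _ "Pow (verts G)"]) (auto simp: independent_def)
  have "independent G {}" by (simp add: independent_def)
  then have "Max (card ` {I. independent G I}) \<in> card ` {I. independent G I}"
    using fin by (intro Max_in) auto
  then obtain I where I: "independent G I" "card I = Max (card ` {I. independent G I})" by auto
  have "card J \<le> card I" if "independent G J" for J
    using fin that I(2) by simp
  then have "is_arg_max card (independent G) I"
    using I(1) by (auto simp: is_arg_max_def not_less)
  then show ?thesis by (auto simp: MIS_def)
qed

lemma MIS_subset_verts: "I \<in> MIS G \<Longrightarrow> I \<subseteq> verts G"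
  by (simp add: MIS_def is_arg_max_def independent_def)


section \<open>Weights by level\<close>

text \<open>Strict ancestors of \<open>u\<close> are also strict ancestors of \<open>v\<close>, and
  \<open>u\<close> itself is one more. Finiteness matters because \<open>card\<close> is 0 on
  infinite sets.\<close>

lemma lvl_less:
  assumes "finite F" "acyclic F" "(v, u) \<in> F\<^sup>+"
  shows "lvl F u < lvl F v"
  unfolding lvl_def
proof (rule psubset_card_mono)
  have "{y. ancestor F y v \<and> y \<noteq> v} \<subseteq> Range F"
    by (auto simp: ancestor_def elim: rtranclE)
  then show "finite {y. ancestor F y v \<and> y \<noteq> v}"
    using assms(1) by (meson finite_Range finite_subset)
  have "(v, y) \<in> F\<^sup>+" if "(u, y) \<in> F\<^sup>*" for y
    using assms(3) that by (rule trancl_rtrancl_trancl)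
  then show "{y. ancestor F y u \<and> y \<noteq> u} \<subset> {y. ancestor F y v \<and> y \<noteq> v}"
    using assms(2,3) unfolding ancestor_def acyclic_def by (blast intro: trancl_into_rtrancl)
qed

lemma ancestors_comparable:
  assumes "single_valued F" "ancestor F s t" "ancestor F u t"
  shows "ancestor F s u \<or> ancestor F u s"
  using single_valued_confluent[OF assms(1)] assms(2,3) unfolding ancestor_def by blast

lemma power2_lvl_isolates:
  assumes G: "simple_graph G" and EF: "elimination_forest G F"
  shows "isolates (\<lambda>u. 2 ^ lvl F u) (MIS G)"
proof (rule ccontr)
  let ?w = "\<lambda>u. 2 ^ lvl F u :: nat"
  have finV: "finite (verts G)" using G by (simp add: simple_graph_def)
  have F: "single_valued F" "acyclic F" "finite F"
    using EF finV by (auto simp: elimination_forest_def rooted_forest_def intro: finite_subset)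
  have edge: "ancestor F u v \<or> ancestor F v u" if "(u, v) \<in> adj G" for u v
    using that EF by (auto simp: elimination_forest_def)
  assume "\<not> isolates ?w (MIS G)"
  then obtain X Y where "X \<noteq> Y" and X: "is_arg_min (sum ?w) (\<lambda>X. X \<in> MIS G) X"
    and Y: "is_arg_min (sum ?w) (\<lambda>X. X \<in> MIS G) Y"
    using MIS_nonempty[OF finV] by (rule not_isolates_obtain)
  have M: "X \<in> MIS G" "Y \<in> MIS G" using X Y by (auto simp: is_arg_min_def)
  have ind: "independent G X" "independent G Y"
    using M by (auto simp: MIS_def is_arg_max_def)
  have max: "card J \<le> card X" "card J \<le> card Y" if "independent G J" for J
    using M that by (auto simp: MIS_def is_arg_max_def not_less)
  have min: "sum ?w X \<le> sum ?w J" "sum ?w Y \<le> sum ?w J" if "J \<in> MIS G" for J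
    using X Y that by (auto simp: is_arg_min_def not_less)
  have fin: "finite X" "finite Y"
    using MIS_subset_verts M finV finite_subset by blast+
  define D where "D = (X - Y) \<union> (Y - X)"
  have "\<exists>u. u \<in> D" using \<open>X \<noteq> Y\<close> by (auto simp: D_def)
  then obtain u where u: "u \<in> D" "\<And>v. v \<in> D \<Longrightarrow> lvl F u \<le> lvl F v"
    using exists_least_iff[of "\<lambda>k. \<exists>u\<in>D. lvl F u = k"] by (metis not_le)
  define T where "T = {v. ancestor F u v}"
  have uT: "u \<in> T" by (simp add: T_def ancestor_def)
  have low: "lvl F u < lvl F v" if "v \<in> T" "v \<noteq> u" for v
    using that F lvl_less[of F v u] by (auto simp: T_def ancestor_def rtrancl_eq_or_trancl)
  \<comment> \<open>An edge leaves the subtree \<open>T\<close> only towards a strict ancestor of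
    \<open>u\<close>: its outer end \<open>s\<close> is comparable to \<open>t\<close> but not below
    it, so \<open>s\<close> and \<open>u\<close> both lie on the root path of \<open>t\<close>. Then
    \<open>s\<close> has smaller level than \<open>u\<close>, and the choice of \<open>u\<close>
    rules out disagreement at \<open>s\<close>.\<close>
  have agree: "s \<in> X \<longleftrightarrow> s \<in> Y" if "t \<in> T" "s \<notin> T" "(s, t) \<in> adj G \<or> (t, s) \<in> adj G" for s t
  proof -
    have "ancestor F s t \<or> ancestor F t s" using edge that(3) by blast
    moreover have "\<not> ancestor F t s"
      using that(1,2) rtrancl_trans[of s t F u] by (auto simp: T_def ancestor_def)
    ultimately have "ancestor F s u"
      using ancestors_comparable[OF F(1), of s t u] that(1,2) by (auto simp: T_def)
    moreover have "s \<noteq> u" using uT that(2) by blast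
    ultimately have "lvl F s < lvl F u"
      using F lvl_less[of F u s] by (auto simp: ancestor_def rtrancl_eq_or_trancl)
    then have "s \<notin> D" using u(2)[of s] by auto
    then show ?thesis by (auto simp: D_def)
  qed
  \<comment> \<open>An edge inside the mixed set would have to cross the border of \<open>T\<close>.
    Its outer end then lies in \<open>B\<close> too, so \<open>B\<close> would contain the
    edge.\<close>
  have exch: "independent G ((A - T) \<union> (B \<inter> T))"
    if "independent G A" "independent G B" "A = X \<and> B = Y \<or> A = Y \<and> B = X" for A B
  proof -
    have *: "\<And>s t. t \<in> T \<Longrightarrow> s \<notin> T \<Longrightarrow> (s, t) \<in> adj G \<or> (t, s) \<in> adj G \<Longrightarrow> s \<in> A \<longleftrightarrow> s \<in> B"
      using agree that(3) by blast
    show ?thesis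
      using that(1,2) * unfolding independent_def by blast
  qed
  have split: "sum f ((A - T) \<union> (B \<inter> T)) = sum f (A - T) + sum f (B \<inter> T)"
    if "finite A" "finite B" for A B and f :: "'a \<Rightarrow> nat"
    using that by (intro sum.union_disjoint) auto
  have split': "sum f A = sum f (A - T) + sum f (A \<inter> T)"
    if "finite A" for A and f :: "'a \<Rightarrow> nat"
    using split[OF that that, of f] by (simp add: Un_Diff_Int)
  let ?X = "(X - T) \<union> (Y \<inter> T)" and ?Y = "(Y - T) \<union> (X \<inter> T)"
  have ind': "independent G ?X" "independent G ?Y" using exch ind by blast+
  \<comment> \<open>Swapping preserves the total size and neither new set can be larger than the
    maximum, so both attain it.\<close>
  have "card ?X + card ?Y = card X + card Y"
    using fin split[of X Y "\<lambda>_. 1"] split[of Y X "\<lambda>_. 1"]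
      split'[of X "\<lambda>_. 1"] split'[of Y "\<lambda>_. 1"] by simp
  then have "card X = card ?X" "card Y = card ?Y"
    using max[OF ind'(1)] max[OF ind'(2)] by linarith+
  then have "?X \<in> MIS G" "?Y \<in> MIS G"
    using ind' max by (auto simp: MIS_def is_arg_max_def not_less)
  then have "sum ?w X \<le> sum ?w ?X" "sum ?w Y \<le> sum ?w ?Y" using min by blast+
  \<comment> \<open>Cancelling the parts outside \<open>T\<close> from the two minimality
    inequalities bounds each inner weight by the other.\<close>
  then have eq: "sum ?w (X \<inter> T) = sum ?w (Y \<inter> T)"
    using fin split[of X Y ?w] split[of Y X ?w] split'[of X ?w] split'[of Y ?w] by simp
  let ?m = "2 ^ Suc (lvl F u) :: nat"
  have dvd: "?m dvd sum ?w A" if "A \<subseteq> T - {u}" for A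
    using that low by (intro dvd_sum le_imp_power_dvd) (auto simp: Suc_le_eq)
  \<comment> \<open>Compare modulo \<open>?m\<close>: one side is \<open>?w u\<close>, half of
    \<open>?m\<close>, the other is 0. Stated for \<open>A\<close> and \<open>B\<close> because
    either of \<open>X\<close> and \<open>Y\<close> may be the one containing
    \<open>u\<close>.\<close>
  have False if "u \<in> A" "u \<notin> B" "finite A" "sum ?w (A \<inter> T) = sum ?w (B \<inter> T)" for A B
  proof -
    have "sum ?w (A \<inter> T) = ?w u + sum ?w (A \<inter> T - {u})"
      using that uT by (intro sum.remove) auto
    moreover have "?m dvd sum ?w (A \<inter> T - {u})" "?m dvd sum ?w (B \<inter> T)"
      using that(2) by (intro dvd; blast)+
    ultimately have "?m dvd ?w u"
      using that(4) by (metis dvd_add_left_iff)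
    then show False by (simp add: dvd_imp_le[THEN leD])
  qed
  from this[of X Y] this[of Y X] show False using u(1) eq fin by (auto simp: D_def)
qed


section \<open>The isolation lemma\<close>

text \<open>Union bound over the ambiguous elements \<open>e\<close>, those in one minimiser but not
  in another (the sets \<open>B e\<close>). Once all other weights are fixed, at most one value of
  \<open>\<omega> e\<close> makes \<open>e\<close> ambiguous, a fraction of 1 in
  \<open>M\<close>.\<close>

lemma isolation_lemma:
  fixes U :: "'a set"
  assumes U: "finite U" and Fam: "\<F> \<subseteq> Pow U" "\<F> \<noteq> {}"
  shows "M * card {\<omega> \<in> U \<rightarrow>\<^sub>E {..<M}. \<not> isolates \<omega> \<F>} \<le> card U * card (U \<rightarrow>\<^sub>E {..<M})"
proof -
  define W where "W = U \<rightarrow>\<^sub>E {..<M}"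
  let ?min = "\<lambda>\<omega>. is_arg_min (sum \<omega>) (\<lambda>X. X \<in> \<F>)"
  define B where "B e = {\<omega> \<in> W. \<exists>X Y. ?min \<omega> X \<and> ?min \<omega> Y \<and> e \<in> X \<and> e \<notin> Y}" for e
  have finW: "finite W" unfolding W_def by (simp add: U finite_PiE)
  have cover: "{\<omega> \<in> W. \<not> isolates \<omega> \<F>} \<subseteq> (\<Union>e\<in>U. B e)"
  proof
    fix \<omega> assume "\<omega> \<in> {\<omega> \<in> W. \<not> isolates \<omega> \<F>}"
    then have w: "\<omega> \<in> W" "\<not> isolates \<omega> \<F>" by auto
    obtain X Y where XY: "X \<noteq> Y" "?min \<omega> X" "?min \<omega> Y"
      using not_isolates_obtain[OF w(2) Fam(2)] by blast
    then have "X \<subseteq> U" "Y \<subseteq> U" using Fam(1) by (auto simp: is_arg_min_def)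
    then show "\<omega> \<in> (\<Union>e\<in>U. B e)"
      using XY w(1) unfolding B_def by blast
  qed
  have cardB: "M * card (B e) \<le> card W" if e: "e \<in> U" for e
  proof -
    \<comment> \<open>Raising only the weight of \<open>e\<close> leaves the cost of
      \<open>Y\<close>, which avoids \<open>e\<close>, unchanged, but makes \<open>X'\<close>, which
      contains \<open>e\<close>, strictly dearer. As \<open>Y\<close> was already optimal,
      \<open>X'\<close> cannot be optimal afterwards.\<close>
    have no_less: False
      if "\<omega> \<in> B e" "\<omega>' \<in> B e" "\<omega> e < \<omega>' e" "\<And>x. x \<noteq> e \<Longrightarrow> \<omega> x = \<omega>' x" for \<omega> \<omega>'
    proof -
      obtain X Y where XY: "?min \<omega> X" "?min \<omega> Y" "e \<in> X" "e \<notin> Y"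
        using \<open>\<omega> \<in> B e\<close> by (auto simp: B_def)
      obtain X' Y' where XY': "?min \<omega>' X'" "?min \<omega>' Y'" "e \<in> X'" "e \<notin> Y'"
        using \<open>\<omega>' \<in> B e\<close> by (auto simp: B_def)
      have mem: "X \<in> \<F>" "Y \<in> \<F>" "X' \<in> \<F>" using XY XY' by (auto simp: is_arg_min_def)
      have "finite X'" using mem Fam(1) U by (auto intro: finite_subset)
      have "sum \<omega>' X' \<le> sum \<omega>' Y"
        using XY' mem by (auto simp: is_arg_min_def not_less)
      also have "sum \<omega>' Y = sum \<omega> Y"
        using XY(4) that(4) by (intro sum.cong refl) metis
      also have "\<dots> \<le> sum \<omega> X'"
        using XY mem by (auto simp: is_arg_min_def not_less)
      also have "\<dots> < sum \<omega>' X'"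
        using \<open>finite X'\<close> XY'(3) that(3,4)
        by (intro sum_strict_mono_ex1 ballI) (auto, metis less_imp_le order_refl)
      finally show False by simp
    qed
    have "inj_on (\<lambda>\<omega>. restrict \<omega> (U - {e})) (B e)"
    proof (rule inj_onI)
      fix \<omega> \<omega>' assume B: "\<omega> \<in> B e" "\<omega>' \<in> B e"
        and r: "restrict \<omega> (U - {e}) = restrict \<omega>' (U - {e})"
      have ext: "\<omega> \<in> extensional U" "\<omega>' \<in> extensional U"
        using B by (auto simp: B_def W_def PiE_def)
      have *: "\<omega> x = \<omega>' x" if "x \<noteq> e" for x
        using fun_cong[OF r, of x] that ext by (cases "x \<in> U") (auto simp: extensional_def)
      then have "\<omega> e = \<omega>' e"
        using no_less[OF B] no_less[OF B(2,1)] by (metis linorder_neqE_nat)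
      then show "\<omega> = \<omega>'" using * by (intro HOL.ext) metis
    qed
    moreover have "restrict \<omega> (U - {e}) \<in> (U - {e}) \<rightarrow>\<^sub>E {..<M}" if "\<omega> \<in> B e" for \<omega>
    proof -
      have "\<omega> \<in> U \<rightarrow>\<^sub>E {..<M}" using that by (simp add: B_def W_def)
      then show ?thesis by (simp add: restrict_PiE_iff PiE_iff)
    qed
    then have "(\<lambda>\<omega>. restrict \<omega> (U - {e})) ` B e \<subseteq> (U - {e}) \<rightarrow>\<^sub>E {..<M}"
      by blast
    ultimately have "card (B e) \<le> card ((U - {e}) \<rightarrow>\<^sub>E {..<M})"
      using U by (intro card_inj_on_le) (auto intro: finite_PiE)
    then have "M * card (B e) \<le> M * M ^ (card U - 1)"
      using U e by (simp add: card_PiE)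
    also have "\<dots> = card W"
      using U e card_Suc_Diff1[OF U e] by (simp add: W_def card_PiE flip: power_Suc)
    finally show ?thesis .
  qed
  have "card {\<omega> \<in> W. \<not> isolates \<omega> \<F>} \<le> (\<Sum>e\<in>U. card (B e))"
    using card_mono[OF _ cover] card_UN_le[OF U, of B] finW U by (auto simp: B_def intro: le_trans)
  then have "M * card {\<omega> \<in> W. \<not> isolates \<omega> \<F>} \<le> (\<Sum>e\<in>U. M * card (B e))"
    by (simp flip: sum_distrib_left)
  also have "\<dots> \<le> card U * card W"
    using sum_bounded_above[of U "\<lambda>e. M * card (B e)" "card W"] cardB by simp
  finally show ?thesis by (simp add: W_def)
qed


section \<open>Few functions serving many families\<close>

text \<open>The sum is a potential which an average choice of the next list element at most doubles.\<close>

lemma exists_list_few_bad: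
  fixes bad :: "'g \<Rightarrow> 'w \<Rightarrow> bool"
  assumes W: "finite W" "W \<noteq> {}" and A: "finite A"
    and few: "\<And>a. a \<in> A \<Longrightarrow> k * card {w \<in> W. bad a w} \<le> card W"
  shows "\<exists>ws. length ws = l \<and> set ws \<subseteq> W \<and>
           (\<Sum>a\<in>A. k ^ length (filter (bad a) ws)) \<le> card A * 2 ^ l"
proof (induction l)
  case 0
  show ?case by simp
next
  case (Suc l)
  then obtain ws where ws: "length ws = l" "set ws \<subseteq> W"
    and pot: "(\<Sum>a\<in>A. k ^ length (filter (bad a) ws)) \<le> card A * 2 ^ l" by blast
  define p where "p a = k ^ length (filter (bad a) ws)" for a
  define q where "q w = (\<Sum>a\<in>A. p a * (if bad a w then k else 1))" for w
  \<comment> \<open>Prepending \<open>w\<close> multiplies the term of \<open>a\<close> by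
    \<open>k\<close> if \<open>w\<close> is bad for it and by 1 otherwise. Bad elements have density
    at most \<open>1/k\<close>, so the average factor is at most 2.\<close>
  have "(\<Sum>w\<in>W. if bad a w then k else 1) \<le> 2 * card W" if "a \<in> A" for a
  proof -
    have "(\<Sum>w\<in>W. if bad a w then k else 1) \<le> (\<Sum>w\<in>W. (if bad a w then k else 0) + 1)"
      by (intro sum_mono) auto
    also have "\<dots> = k * card {w \<in> W. bad a w} + card W"
      unfolding sum.distrib using W(1) by (simp add: sum.If_cases Int_def)
    finally show ?thesis using few[OF that] by simp
  qed
  then have "(\<Sum>a\<in>A. p a * (\<Sum>w\<in>W. if bad a w then k else 1)) \<le> (\<Sum>a\<in>A. p a * (2 * card W))"
    by (intro sum_mono mult_left_mono) auto
  moreover have "sum q W = (\<Sum>a\<in>A. p a * (\<Sum>w\<in>W. if bad a w then k else 1))"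
    unfolding q_def sum_distrib_left by (rule sum.swap)
  moreover have "(\<Sum>a\<in>A. p a * (2 * card W)) = card W * (2 * sum p A)"
    by (simp flip: sum_distrib_right)
  ultimately have tot: "sum q W \<le> card W * (2 * sum p A)" by simp
  have "\<exists>w\<in>W. q w \<le> 2 * sum p A"
  proof (rule ccontr)
    assume "\<not> (\<exists>w\<in>W. q w \<le> 2 * sum p A)"
    then have "(\<Sum>w\<in>W. 2 * sum p A) < sum q W"
      using W by (intro sum_strict_mono) auto
    with tot show False by simp
  qed
  then obtain w where w: "w \<in> W" "q w \<le> 2 * sum p A" by blast
  have "(\<Sum>a\<in>A. k ^ length (filter (bad a) (w # ws))) = q w"
    unfolding q_def p_def by (intro sum.cong) auto
  also have "\<dots> \<le> card A * 2 ^ Suc l" using w(2) pot by (simp add: p_def)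
  finally show ?case using ws w(1) by (intro exI[of _ "w # ws"]) auto
qed

text \<open>With \<open>k = 16\<close> the final potential is at most
  \<open>2 ^ n\<^sup>2 * 2 ^ n\<^sup>2 = 4 ^ n\<^sup>2\<close>. A graph with \<open>b\<close> bad
  functions alone contributes \<open>16 ^ b = 4 ^ (2 * b)\<close>, hence at most half are
  bad.\<close>

lemma exists_list_isolating_MIS:
  assumes n: "n > 0"
  shows "\<exists>ws. length ws = n\<^sup>2 \<and> set ws \<subseteq> {1..n} \<rightarrow>\<^sub>E {..<16 * n} \<and>
    (\<forall>G. simple_graph G \<and> verts G = {1..n} \<longrightarrow>
       2 * length (filter (\<lambda>\<omega>. \<not> isolates \<omega> (MIS G)) ws) \<le> n\<^sup>2)"
proof -
  let ?W = "{1..n} \<rightarrow>\<^sub>E {..<16 * n}"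
  define A where "A = {G :: nat graph. simple_graph G \<and> verts G = {1..n}}"
  have sub: "A \<subseteq> Pair {1..n} ` Pow ({1..n} \<times> {1..n})"
    by (force simp: A_def simple_graph_def verts_def adj_def)
  then have finA: "finite A" by (rule finite_subset) simp
  have "card A \<le> card (Pow ({1..n} \<times> {1..n}))"
    using sub by (intro surj_card_le) auto
  also have "\<dots> = 2 ^ n\<^sup>2" by (simp add: card_Pow card_cartesian_product power2_eq_square)
  finally have cardA: "card A \<le> 2 ^ n\<^sup>2" .
  \<comment> \<open>The range \<open>16 * n\<close> is chosen so that the factor
    \<open>card U = n\<close> of the isolation lemma cancels.\<close>
  have few: "16 * card {\<omega> \<in> ?W. \<not> isolates \<omega> (MIS G)} \<le> card ?W" if "G \<in> A" for G
  proof -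
    have "16 * n * card {\<omega> \<in> ?W. \<not> isolates \<omega> (MIS G)} \<le> card {1..n} * card ?W"
      using that MIS_nonempty[of G] MIS_subset_verts[of _ G]
      by (intro isolation_lemma) (auto simp: A_def)
    then have "n * (16 * card {\<omega> \<in> ?W. \<not> isolates \<omega> (MIS G)}) \<le> n * card ?W"
      by (simp add: mult_ac)
    then show ?thesis using n by simp
  qed
  have W: "finite ?W" "?W \<noteq> {}"
    using n by (auto simp: finite_PiE PiE_eq_empty_iff lessThan_empty_iff)
  obtain ws where ws: "length ws = n\<^sup>2" "set ws \<subseteq> ?W" and
    pot: "(\<Sum>G\<in>A. 16 ^ length (filter (\<lambda>\<omega>. \<not> isolates \<omega> (MIS G)) ws)) \<le> card A * 2 ^ n\<^sup>2"
    using exists_list_few_bad[where A = A and l = "n\<^sup>2" and bad = "\<lambda>G \<omega>. \<not> isolates \<omega> (MIS G)",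
        OF W finA few] by blast
  have "2 * length (filter (\<lambda>\<omega>. \<not> isolates \<omega> (MIS G)) ws) \<le> n\<^sup>2" if "G \<in> A" for G
  proof -
    let ?b = "length (filter (\<lambda>\<omega>. \<not> isolates \<omega> (MIS G)) ws)"
    have "(4::nat) ^ (2 * ?b) = 16 ^ ?b" by (simp add: power_mult)
    also have "\<dots> \<le> (\<Sum>G\<in>A. 16 ^ length (filter (\<lambda>\<omega>. \<not> isolates \<omega> (MIS G)) ws))"
      using member_le_sum[OF that, of "\<lambda>G. (16::nat) ^ length (filter (\<lambda>\<omega>. \<not> isolates \<omega> (MIS G)) ws)"] finA
      by simp
    also have "\<dots> \<le> 2 ^ n\<^sup>2 * 2 ^ n\<^sup>2"
      using pot cardA by (meson le_trans mult_le_mono1)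
    also have "\<dots> = 4 ^ n\<^sup>2" by (simp flip: power_mult_distrib)
    finally show ?thesis by simp
  qed
  then show ?thesis using ws by (auto simp: A_def)
qed

section \<open>Assembling the scheme and bounding its parameters\<close>

lemma max_weight_le:
  assumes "\<And>\<omega> u i. \<omega> \<in> set ws \<Longrightarrow> u \<in> {1..n} \<Longrightarrow> i < d \<Longrightarrow> \<omega> u i \<le> b"
  shows "max_weight n d ws \<le> b"
proof -
  have "{\<omega> u i | \<omega> u i. \<omega> \<in> set ws \<and> u \<in> {1..n} \<and> i < d}
      = (\<lambda>(\<omega>, u, i). \<omega> u i) ` (set ws \<times> {1..n} \<times> {..<d})"
    by force
  then have "finite {\<omega> u i | \<omega> u i. \<omega> \<in> set ws \<and> u \<in> {1..n} \<and> i < d}" by simp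
  then show ?thesis unfolding max_weight_def using assms by (subst Max_le_iff) auto
qed

theorem theorem1p8:
  shows "\<exists>c C :: real. \<forall>d n :: nat. \<exists>ws.
           level_aware_isolation_scheme MIS n d ws \<and>
           random_bits ws \<le> c * real d \<and>
           real (max_weight n d ws) \<le> C * real n ^ 6"
proof (rule exI[of _ 2], rule exI[of _ 16], intro allI)
  fix d n :: nat
  have bound: "real m \<le> 16 * real n ^ 6" if "m \<le> 16 * n" for m
  proof -
    have "n \<le> n ^ 6" by (cases "n = 0") (auto intro: self_le_power)
    then have "m \<le> 16 * n ^ 6" using that by linarith
    then have "real m \<le> real (16 * n ^ 6)" by (rule of_nat_mono)
    then show ?thesis by simp
  qed
  show "\<exists>ws. level_aware_isolation_scheme MIS n d ws \<and> random_bits ws \<le> 2 * real d \<and>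
          real (max_weight n d ws) \<le> 16 * real n ^ 6"
  \<comment> \<open>The case \<open>n = 0\<close> joins the single-function case, since
    \<open>n\<^sup>2\<close> functions would be an empty list. One function costs
    \<open>log 2 1 = 0\<close> bits.\<close>
  proof (cases "2 ^ d \<le> n \<or> n = 0")
    case True
    let ?ws = "[\<lambda>u i. 2 ^ i] :: (nat \<Rightarrow> nat \<Rightarrow> nat) list"
    have "level_aware_isolation_scheme MIS n d ?ws"
      using power2_lvl_isolates by (auto simp: level_aware_isolation_scheme_def)
    moreover have "max_weight n d ?ws \<le> 16 * n"
    proof (rule max_weight_le)
      fix \<omega> u i assume *: "\<omega> \<in> set ?ws" "u \<in> {1..n}" "i < d"
      then have "(2::nat) ^ i \<le> 2 ^ d" by simp
      also have "\<dots> \<le> n" using * True by auto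
      finally show "\<omega> u i \<le> 16 * n" using * by simp
    qed
    ultimately show ?thesis
      using bound by (intro exI[of _ ?ws]) (simp add: random_bits_def)
  next
    case False
    then have n: "n > 0" "n < 2 ^ d" by auto
    obtain ws where ws: "length ws = n\<^sup>2" "set ws \<subseteq> {1..n} \<rightarrow>\<^sub>E {..<16 * n}"
      and half: "\<And>G. simple_graph G \<Longrightarrow> verts G = {1..n} \<Longrightarrow>
        2 * length (filter (\<lambda>\<omega>. \<not> isolates \<omega> (MIS G)) ws) \<le> n\<^sup>2"
      using exists_list_isolating_MIS[OF n(1)] by blast
    let ?ws = "map (\<lambda>\<omega> u i. \<omega> u) ws"
    have "real (length (filter (\<lambda>\<omega>. isolates (\<lambda>u. \<omega> u (lvl F u)) (MIS G)) ?ws))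
        \<ge> real (length ?ws) / 2" if "simple_graph G" "verts G = {1..n}" for G F
    proof -
      have "length ?ws \<le> 2 * length (filter (\<lambda>\<omega>. isolates \<omega> (MIS G)) ws)"
        using half[OF that] sum_length_filter_compl[of "\<lambda>\<omega>. isolates \<omega> (MIS G)" ws] ws(1)
        by simp
      then show ?thesis by (simp add: filter_map o_def)
    qed
    then have "level_aware_isolation_scheme MIS n d ?ws"
      using ws(1) n(1) by (auto simp: level_aware_isolation_scheme_def)
    moreover have "max_weight n d ?ws \<le> 16 * n"
      using ws(2) by (intro max_weight_le) (fastforce dest: PiE_mem intro: less_imp_le)
    \<comment> \<open>The constant 2 is the exponent in the list length \<open>n\<^sup>2\<close>, as
      \<open>log 2 n\<close> is below \<open>d\<close> here.\<close>
    moreover have "random_bits ?ws \<le> 2 * real d"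
    proof -
      have "real n < 2 ^ d" using n(2) by (metis of_nat_less_iff of_nat_numeral of_nat_power)
      then have "log 2 (real n) \<le> real d"
        using n(1) by (intro less_imp_le) (simp add: log_less_iff powr_realpow)
      then show ?thesis
        using n(1) by (simp add: random_bits_def ws(1) log_nat_power)
    qed
    ultimately show ?thesis using bound by blast
  qed
qed

end
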